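(* There exist absolute constants $c,c'>0$ and $n_0$ such that for every $n\ge n_0$ there is a function $f:\{0,1\}^{n^2}\to\{0,1\}$ with $bs(f)\le bs^*(f)\le c\,n$ and $C(f)\ge c'\,n^2$.
   Context: For $x\in\{0,1\}^N$ and $B\subseteq[N]$, $x\oplus B$ is $x$ with the bits in $B$ flipped; a block of $f$ at $x$ is $B$ with $f(x\oplus B)\ne f(x)$. $bs_x(f)$ is the maximum number of pairwise disjoint blocks at $x$; $bs^*_x(f)$ is the maximum of $\sum_B\lambda(B)$ over nonnegative $\lambda$ on blocks at $x$ with $\sum_{B\ni i}\lambda(B)\le1$ for every $i$; $C_x(f)$ is the minimum size of a set $S\subseteq[N]$ meeting every block at $x$. For $m\in\{bs,bs^*,C\}$, $m(f)=\max_x m_x(f)$. *)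

theory Defs
  imports "HOL-Analysis.Analysis"
begin

(* A point of {0,1}^N is a bool list of length N, with [N] rendered as {..<N}.  A function
   {0,1}^N -> {0,1} is a total f :: bool list => bool; every notion below evaluates f only at
   lists of length N, so the values of f elsewhere are irrelevant. *)

definition cube :: "nat \<Rightarrow> bool list set" where
  "cube N = {x. length x = N}"

definition flip :: "bool list \<Rightarrow> nat set \<Rightarrow> bool list" where
  "flip x B = map (\<lambda>i. if i \<in> B then \<not> x ! i else x ! i) [0..<length x]"

definition blocks :: "nat \<Rightarrow> (bool list \<Rightarrow> bool) \<Rightarrow> bool list \<Rightarrow> nat set set" where
  "blocks N f x = {B. B \<subseteq> {..<N} \<and> f (flip x B) \<noteq> f x}"

definition bs_at :: "nat \<Rightarrow> (bool list \<Rightarrow> bool) \<Rightarrow> bool list \<Rightarrow> nat" where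
  "bs_at N f x = Max {card F |F. F \<subseteq> blocks N f x \<and> pairwise disjnt F}"

definition fractional_packing ::
    "nat \<Rightarrow> (bool list \<Rightarrow> bool) \<Rightarrow> bool list \<Rightarrow> (nat set \<Rightarrow> real) \<Rightarrow> bool" where
  "fractional_packing N f x w \<longleftrightarrow>
     (\<forall>B \<in> blocks N f x. 0 \<le> w B) \<and>
     (\<forall>i<N. (\<Sum>B | B \<in> blocks N f x \<and> i \<in> B. w B) \<le> 1)"

(* The supremum is a maximum: see fbs_at_is_max below. *)
definition fbs_at :: "nat \<Rightarrow> (bool list \<Rightarrow> bool) \<Rightarrow> bool list \<Rightarrow> real" where
  "fbs_at N f x = Sup {\<Sum>B \<in> blocks N f x. w B |w. fractional_packing N f x w}"

definition cert_at :: "nat \<Rightarrow> (bool list \<Rightarrow> bool) \<Rightarrow> bool list \<Rightarrow> nat" where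
  "cert_at N f x = Min {card S |S. S \<subseteq> {..<N} \<and> (\<forall>B \<in> blocks N f x. S \<inter> B \<noteq> {})}"

definition block_sensitivity :: "nat \<Rightarrow> (bool list \<Rightarrow> bool) \<Rightarrow> nat" where
  "block_sensitivity N f = Max (bs_at N f ` cube N)"

definition fractional_block_sensitivity :: "nat \<Rightarrow> (bool list \<Rightarrow> bool) \<Rightarrow> real" where
  "fractional_block_sensitivity N f = Max (fbs_at N f ` cube N)"

definition certificate_complexity :: "nat \<Rightarrow> (bool list \<Rightarrow> bool) \<Rightarrow> nat" where
  "certificate_complexity N f = Max (cert_at N f ` cube N)"

lemma finite_cube: "finite (cube N)"
  using finite_lists_length_eq[of "UNIV :: bool set" N] by (simp add: cube_def)

lemma cube_nonempty: "cube N \<noteq> {}"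
  by (auto simp: cube_def intro: exI[of _ "replicate N False"])

lemma finite_blocks: "finite (blocks N f x)"
  by (rule finite_subset[of _ "Pow {..<N}"]) (auto simp: blocks_def)

lemma flip_empty: "flip x {} = x"
  by (simp add: flip_def map_nth)

lemma block_nonempty: "B \<in> blocks N f x \<Longrightarrow> B \<noteq> {}"
  by (auto simp: blocks_def flip_empty)

lemma fractional_packing_le_1:
  assumes "fractional_packing N f x w" "B \<in> blocks N f x"
  shows "w B \<le> 1"
proof -
  obtain i where i: "i \<in> B" "i < N"
    using block_nonempty[OF assms(2)] assms(2) by (auto simp: blocks_def)
  have "w B \<le> (\<Sum>B | B \<in> blocks N f x \<and> i \<in> B. w B)"
    using assms i finite_blocks[of N f x]
    by (intro member_le_sum) (auto simp: fractional_packing_def)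
  also have "\<dots> \<le> 1"
    using assms(1) i by (auto simp: fractional_packing_def)
  finally show ?thesis .
qed

lemma fbs_at_is_max:
  "\<exists>w. fractional_packing N f x w \<and> fbs_at N f x = (\<Sum>B \<in> blocks N f x. w B) \<and>
       (\<forall>v. fractional_packing N f x v \<longrightarrow> (\<Sum>B \<in> blocks N f x. v B) \<le> fbs_at N f x)"
proof -
  let ?Bl = "blocks N f x"
  let ?val = "\<lambda>w :: nat set \<Rightarrow> real. \<Sum>B \<in> ?Bl. w B"
  define K where "K = PiE UNIV (\<lambda>B. if B \<in> ?Bl then {0..1} else {0 :: real})"
  define P where "P = K \<inter> (\<Inter>i\<in>{..<N}. {w. (\<Sum>B | B \<in> ?Bl \<and> i \<in> B. w B) \<le> 1})"
  have "compact K"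
    unfolding K_def compactin_euclidean_iff[symmetric] euclidean_product_topology[symmetric]
    by (subst compactin_PiE) auto
  moreover have "closed (\<Inter>i\<in>{..<N}. {w. (\<Sum>B | B \<in> ?Bl \<and> i \<in> B. w B) \<le> (1 :: real)})"
    by (intro closed_INT ballI closed_Collect_le continuous_on_sum
        continuous_on_product_coordinates continuous_on_const)
  ultimately have "compact P"
    unfolding P_def by (rule compact_Int_closed)
  moreover have "(\<lambda>_. 0) \<in> P"
    by (auto simp: P_def K_def)
  moreover have "continuous_on P ?val"
    by (intro continuous_on_sum continuous_on_subset[OF continuous_on_product_coordinates]) auto
  ultimately obtain w where w: "w \<in> P" "\<And>v. v \<in> P \<Longrightarrow> ?val v \<le> ?val w"
    using continuous_attains_sup[of P ?val] by blast
  have fw: "fractional_packing N f x w"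
    using w(1) by (auto simp: P_def K_def fractional_packing_def PiE_iff split: if_splits)
  have le: "?val v \<le> ?val w" if v: "fractional_packing N f x v" for v
  proof -
    define v' where "v' = (\<lambda>B. if B \<in> ?Bl then v B else 0)"
    have "v' \<in> P"
      using v fractional_packing_le_1[OF v]
      by (auto simp: P_def K_def v'_def fractional_packing_def)
    moreover have "?val v' = ?val v"
      by (auto simp: v'_def)
    ultimately show ?thesis
      using w(2) by metis
  qed
  have "fbs_at N f x = ?val w"
    unfolding fbs_at_def using fw le by (intro cSup_eq_maximum) auto
  then show ?thesis
    using fw le by auto
qed

end

theory Submission
  imports Defs
begin

text \<open>
  Read an input of length $n^2$ as $n$ subsets of $[n]$ and let $f$ accept iff one of them lies
  in a family $A$ whose members are pairwise at Hamming distance greater than $m \approx n/14$.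
  At a rejecting input each of the $n$ subsets has at most one member of $A$ within distance
  $m/2$, so one coordinate of weight $1$ together with the uniform weight $2/(m+1)$ is a
  fractional hitting set of cost $O(1)$ per subset. At an accepting input the $n$ coordinates
  of one accepted subset hit every block. By LP duality the fractional block sensitivity is
  $O(n)$. If moreover every set of size at most $m$ misses some member of $A$, a certificate at
  the zero input needs more than $m$ coordinates in each of the $n$ subsets. Such an $A$ is
  chosen greedily: the number of small sets times the volume of a Hamming ball is less than
  $2^{n-m}$.
\<close>

section \<open>The code\<close>

definition small_sets :: "nat \<Rightarrow> nat \<Rightarrow> nat set set" where
  "small_sets n m = {S. S \<subseteq> {..<n} \<and> card S \<le> m}"

lemma finite_small_sets: "finite (small_sets n m)"
  by (rule finite_subset[of _ "Pow {..<n}"]) (auto simp: small_sets_def)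

lemma sum_Pow_power_card:
  fixes t :: "'a :: comm_semiring_1"
  assumes "finite X"
  shows "(\<Sum>S\<in>Pow X. t ^ card S) = (1 + t) ^ card X"
  using assms
proof (induction X rule: finite_induct)
  case (insert x X)
  have inj: "inj_on (Set.insert x) (Pow X)"
    using insert.hyps by (auto simp: inj_on_def)
  have "(\<Sum>S\<in>Pow (Set.insert x X). t ^ card S)
      = (\<Sum>S\<in>Pow X. t ^ card S) + (\<Sum>S\<in>Set.insert x ` Pow X. t ^ card S)"
    unfolding Pow_insert using insert.hyps by (intro sum.union_disjoint) auto
  also have "(\<Sum>S\<in>Set.insert x ` Pow X. t ^ card S) = (\<Sum>S\<in>Pow X. t * t ^ card S)"
    unfolding sum.reindex[OF inj] o_def
  proof (rule sum.cong)
    fix S assume "S \<in> Pow X"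
    then have "finite S" "x \<notin> S"
      using insert.hyps finite_subset by auto
    then show "t ^ card (Set.insert x S) = t * t ^ card S" by simp
  qed simp
  finally show ?case
    using insert by (simp add: sum_distrib_left[symmetric] distrib_right)
qed simp

text \<open>A Chernoff-type estimate: give each subset \<open>S\<close> of \<open>{..<n}\<close> the
  weight \<open>(1/8) ^ card S\<close>. A small set weighs at least \<open>(1/8) ^ m\<close>, and
  all subsets together weigh \<open>(1 + 1/8) ^ n\<close>. The base 1/8 is small enough for the
  comparison in \<open>card_small_sets_square_less\<close>.\<close>

lemma card_small_sets_le:
  "real (card (small_sets n m)) \<le> (9/8) ^ n * 8 ^ m"
proof -
  have "real (card (small_sets n m)) * (1/8) ^ m = (\<Sum>S\<in>small_sets n m. (1/8) ^ m)"
    by simp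
  also have "\<dots> \<le> (\<Sum>S\<in>small_sets n m. (1/8) ^ card S)"
    by (intro sum_mono power_decreasing) (auto simp: small_sets_def)
  also have "\<dots> \<le> (\<Sum>S\<in>Pow {..<n}. (1/8) ^ card S)"
    by (intro sum_mono2) (auto simp: small_sets_def)
  also have "\<dots> = (9/8 :: real) ^ n"
    by (subst sum_Pow_power_card) auto
  finally show ?thesis
    by (simp add: power_divide field_simps)
qed

text \<open>Prepares a union bound: one factor bounds the number of sets chosen so far, the other is
  the volume of the ball of radius \<open>m\<close> around each. The right-hand side is a lower
  bound on the number of subsets of \<open>{..<n}\<close> that avoid a given small set.\<close>

lemma card_small_sets_square_less:
  assumes "14 * m \<le> n" "n > 0"
  shows "card (small_sets n m) * card (small_sets n m) < 2 ^ (n - m)"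
proof -
  define V where "V = real (card (small_sets n m))"
  have "V * V * 2 ^ m \<le> ((9/8) ^ n * 8 ^ m) * ((9/8) ^ n * 8 ^ m) * 2 ^ m"
    unfolding V_def by (intro mult_mono card_small_sets_le) auto
  also have "\<dots> = (81/64) ^ n * 128 ^ m"
    by (simp add: power_mult_distrib[symmetric] mult_ac)
  finally have le: "V * V * 2 ^ m \<le> (81/64) ^ n * 128 ^ m" .
  \<comment> \<open>Squaring avoids a square root of 2: it turns \<open>128 ^ m\<close> into
    \<open>2 ^ (14 * m)\<close>, which is at most \<open>2 ^ n\<close>. What remains is that
    6561/2048 is below 4.\<close>
  have "(V * V * 2 ^ m)\<^sup>2 \<le> ((81/64) ^ n * 128 ^ m)\<^sup>2"
    using le by (intro power_mono) (auto simp: V_def)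
  also have "\<dots> = (6561/4096) ^ n * 2 ^ (14 * m)"
  proof -
    have "((81/64 :: real) ^ n)\<^sup>2 = (6561/4096) ^ n"
      unfolding power2_eq_square by (simp flip: power_mult_distrib)
    moreover have "((128 :: real) ^ m)\<^sup>2 = 2 ^ (14 * m)"
      unfolding power2_eq_square by (simp add: power_mult flip: power_mult_distrib)
    ultimately show ?thesis by (simp only: power_mult_distrib)
  qed
  also have "\<dots> \<le> (6561/4096) ^ n * 2 ^ n"
    using assms by (intro mult_left_mono power_increasing) auto
  also have "\<dots> = (6561/2048) ^ n"
    by (simp flip: power_mult_distrib)
  also have "\<dots> < 4 ^ n"
    using assms by (intro power_strict_mono) auto
  also have "\<dots> = (2 ^ n)\<^sup>2"
    by (simp add: power2_eq_square flip: power_mult_distrib)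
  finally have "V * V * 2 ^ m < 2 ^ n"
    by (rule power2_less_imp_less) simp
  also have "(2 :: real) ^ n = 2 ^ (n - m) * 2 ^ m"
    using assms by (simp flip: power_add)
  finally have "V * V < 2 ^ (n - m)" by simp
  then have "real (card (small_sets n m) * card (small_sets n m)) < real (2 ^ (n - m))"
    by (simp add: V_def)
  then show ?thesis
    by (simp only: of_nat_less_iff)
qed

section \<open>Greedy choice of a separated family that avoids every small set\<close>

definition separated :: "nat \<Rightarrow> 'a set set \<Rightarrow> bool" where
  "separated m A \<longleftrightarrow> (\<forall>a\<in>A. \<forall>b\<in>A. a \<noteq> b \<longrightarrow> m < card (sym_diff a b))"

lemma separated_mono: "separated m B \<Longrightarrow> A \<subseteq> B \<Longrightarrow> separated m A"
  by (auto simp: separated_def)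

lemma separated_insert:
  assumes "separated m A" "\<And>a. a \<in> A \<Longrightarrow> m < card (sym_diff a b)"
  shows "separated m (insert b A)"
  using assms unfolding separated_def by (auto simp: Un_commute)

text \<open>One greedy step, by counting: the balls of radius \<open>m\<close> around the members of
  \<open>A\<close> contain fewer sets in total than there are subsets of \<open>{..<n}\<close>
  disjoint from \<open>S\<close>.\<close>

lemma exists_far_set_avoiding:
  assumes "14 * m \<le> n" "n > 0"
    and A: "finite A" "card A \<le> card (small_sets n m)" "A \<subseteq> Pow {..<n}"
    and S: "S \<in> small_sets n m"
  shows "\<exists>b \<subseteq> {..<n}. b \<inter> S = {} \<and> (\<forall>a\<in>A. m < card (sym_diff a b))"
proof -
  \<comment> \<open>The union of the balls of radius \<open>m\<close>, each written as the translate
    by its centre of the ball around the empty set.\<close>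
  let ?U = "\<Union>a\<in>A. sym_diff a ` small_sets n m"
  have "card ?U \<le> (\<Sum>a\<in>A. card (sym_diff a ` small_sets n m))"
    using A by (intro card_UN_le) auto
  also have "\<dots> \<le> (\<Sum>a\<in>A. card (small_sets n m))"
    by (intro sum_mono card_image_le finite_small_sets)
  also have "\<dots> \<le> card (small_sets n m) * card (small_sets n m)"
    using A by simp
  also have "\<dots> < 2 ^ (n - m)"
    using assms by (intro card_small_sets_square_less)
  also have "\<dots> \<le> 2 ^ (n - card S)"
    using S by (intro power_increasing) (auto simp: small_sets_def)
  also have "\<dots> = card (Pow ({..<n} - S))"
    using S by (subst card_Pow) (auto simp: small_sets_def card_Diff_subset finite_subset)
  finally have "\<not> Pow ({..<n} - S) \<subseteq> ?U"
    using A finite_small_sets by (metis (no_types, lifting) card_mono finite_UN finite_imageI not_le)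
  then obtain b where b: "b \<subseteq> {..<n} - S" "b \<notin> ?U" by blast
  have "m < card (sym_diff a b)" if "a \<in> A" for a
  proof (rule ccontr)
    assume "\<not> m < card (sym_diff a b)"
    then have "sym_diff a b \<in> small_sets n m"
      using that A b by (auto simp: small_sets_def)
    \<comment> \<open>Translation by \<open>a\<close> is an involution, so a small difference from
      \<open>a\<close> puts \<open>b\<close> in the ball around \<open>a\<close>.\<close>
    moreover have "b = sym_diff a (sym_diff a b)" by blast
    ultimately have "b \<in> sym_diff a ` small_sets n m" by (rule rev_image_eqI)
    then show False using b that by blast
  qed
  then show ?thesis using b by blast
qed

lemma exists_separated_avoiding:
  assumes "14 * m \<le> n" "n > 0"
  shows "\<exists>A \<subseteq> Pow {..<n}. {} \<notin> A \<and> separated m A \<and>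
           (\<forall>S\<in>small_sets n m. \<exists>a\<in>A. a \<inter> S = {})"
proof -
  \<comment> \<open>The empty set is kept in the family during the induction, which forces every new
    member to be nonempty; the extra 1 in the cardinality bound accounts for it. It may not serve as
    a witness and is removed at the end.\<close>
  have "\<exists>A \<subseteq> Pow {..<n}. {} \<in> A \<and> card A \<le> card T + 1 \<and> separated m A \<and>
          (\<forall>S\<in>T. \<exists>a\<in>A - {{}}. a \<inter> S = {})"
    if "finite T" "T \<subseteq> small_sets n m" for T
    using that
  proof (induction T rule: finite_induct)
    case empty
    show ?case by (rule exI[of _ "{{}}"]) (auto simp: separated_def)
  next
    case (insert S T)
    then obtain A where A: "A \<subseteq> Pow {..<n}" "{} \<in> A" "card A \<le> card T + 1" "separated m A"
        "\<forall>S\<in>T. \<exists>a\<in>A - {{}}. a \<inter> S = {}"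
      by auto
    have fin: "finite A" using A(1) by (rule finite_subset) auto
    \<comment> \<open>Since \<open>S\<close> is not in \<open>T\<close>, the extra 1 is absorbed
      here, and \<open>A\<close> is still small enough for another greedy step.\<close>
    have "card A \<le> card (Set.insert S T)" using A insert.hyps by simp
    also have "\<dots> \<le> card (small_sets n m)"
      using insert.prems by (intro card_mono finite_small_sets)
    finally have "card A \<le> card (small_sets n m)" .
    then obtain b where b: "b \<subseteq> {..<n}" "b \<inter> S = {}" "\<And>a. a \<in> A \<Longrightarrow> m < card (sym_diff a b)"
      using exists_far_set_avoiding[of m n A S] assms fin A(1) insert.prems by auto
    have "b \<noteq> {}" using b(3)[OF A(2)] by auto
    show ?case
    proof (intro exI[of _ "Set.insert b A"] conjI ballI)
      show "card (Set.insert b A) \<le> card (Set.insert S T) + 1"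
        using A(3) insert.hyps fin by (simp add: card_insert_if)
      show "separated m (Set.insert b A)"
        using A(4) b(3) by (rule separated_insert)
      show "\<exists>a\<in>Set.insert b A - {{}}. a \<inter> S' = {}" if "S' \<in> Set.insert S T" for S'
      proof (cases "S' = S")
        case True
        then show ?thesis using \<open>b \<noteq> {}\<close> b(2) by auto
      next
        case False
        then show ?thesis using that A(5) by auto
      qed
    qed (use A b in auto)
  qed
  from this[OF finite_small_sets subset_refl] obtain A where
    "A \<subseteq> Pow {..<n}" "separated m A" "\<forall>S\<in>small_sets n m. \<exists>a\<in>A - {{}}. a \<inter> S = {}"
    by blast
  then show ?thesis
    using separated_mono[of m A "A - {{}}"] by (intro exI[of _ "A - {{}}"]) auto
qed

section \<open>Block sensitivity and its fractional relaxation\<close>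

text \<open>Weak LP duality: evaluate the sum of \<open>w B * z i\<close> over all pairs with
  \<open>i \<in> B\<close> in both orders. Summing over \<open>i\<close> first gives at least the
  value of the packing, summing over \<open>B\<close> first at most the cost of
  \<open>z\<close>.\<close>

lemma fbs_at_le_fractional_hitting_set:
  assumes z: "\<And>i. i < N \<Longrightarrow> 0 \<le> z i"
    and hit: "\<And>B. B \<in> blocks N f x \<Longrightarrow> 1 \<le> (\<Sum>i\<in>B. z i)"
  shows "fbs_at N f x \<le> (\<Sum>i<N. z i)"
proof -
  let ?Bl = "blocks N f x"
  obtain w where w: "fractional_packing N f x w" "fbs_at N f x = (\<Sum>B\<in>?Bl. w B)"
    using fbs_at_is_max by blast
  have "(\<Sum>B\<in>?Bl. w B) \<le> (\<Sum>B\<in>?Bl. w B * (\<Sum>i\<in>B. z i))"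
  proof (rule sum_mono)
    fix B assume B: "B \<in> ?Bl"
    then have "0 \<le> w B" using w by (auto simp: fractional_packing_def)
    then show "w B \<le> w B * (\<Sum>i\<in>B. z i)"
      using mult_left_mono[OF hit[OF B]] by fastforce
  qed
  also have "\<dots> = (\<Sum>B\<in>?Bl. \<Sum>i<N. if i \<in> B then w B * z i else 0)"
  proof (rule sum.cong)
    fix B assume "B \<in> ?Bl"
    then have "{..<N} \<inter> B = B" by (auto simp: blocks_def)
    then show "w B * (\<Sum>i\<in>B. z i) = (\<Sum>i<N. if i \<in> B then w B * z i else 0)"
      by (simp add: sum.inter_restrict[symmetric] sum_distrib_left)
  qed simp
  also have "\<dots> = (\<Sum>i<N. \<Sum>B\<in>?Bl. if i \<in> B then w B * z i else 0)"
    by (rule sum.swap)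
  also have "\<dots> = (\<Sum>i<N. z i * (\<Sum>B | B \<in> ?Bl \<and> i \<in> B. w B))"
    by (simp add: sum.inter_filter finite_blocks sum_distrib_left mult.commute if_distrib cong: if_cong)
  also have "\<dots> \<le> (\<Sum>i<N. z i * 1)"
    using w(1) z by (intro sum_mono mult_left_mono) (auto simp: fractional_packing_def)
  finally show ?thesis using w by simp
qed

lemma sum_indicator_card:
  "finite X \<Longrightarrow> (\<Sum>x\<in>X. indicator Y x) = real (card (X \<inter> Y))"
  by (simp add: indicator_def sum.inter_restrict[symmetric])

text \<open>Among pairwise disjoint blocks at most one contains a given index.\<close>

lemma fractional_packing_indicator:
  assumes F: "F \<subseteq> blocks N f x" "pairwise disjnt F"
  shows "fractional_packing N f x (indicator F)"
  unfolding fractional_packing_def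
proof (intro conjI ballI allI impI)
  fix i
  let ?X = "{B. B \<in> blocks N f x \<and> i \<in> B}"
  have "finite ?X" using finite_blocks by simp
  then have "(\<Sum>B\<in>?X. indicator F B) = real (card (?X \<inter> F))"
    by (simp add: sum_indicator_card)
  also have "card (?X \<inter> F) \<le> 1"
    using F(2) \<open>finite ?X\<close> by (subst One_nat_def, subst card_le_Suc0_iff_eq)
      (auto simp: pairwise_def disjnt_def)
  finally show "(\<Sum>B\<in>?X. indicator F B) \<le> (1 :: real)" by simp
qed simp

lemma bs_at_le_fbs_at: "real (bs_at N f x) \<le> fbs_at N f x"
proof -
  let ?C = "{card F |F. F \<subseteq> blocks N f x \<and> pairwise disjnt F}"
  have "?C \<subseteq> card ` Pow (blocks N f x)" by auto
  then have "finite ?C"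
    by (rule finite_subset) (simp add: finite_blocks)
  moreover have "?C \<noteq> {}" by (auto intro!: exI[of _ "{}"])
  ultimately have "bs_at N f x \<in> ?C"
    unfolding bs_at_def by (rule Max_in)
  then obtain F where F: "bs_at N f x = card F" "F \<subseteq> blocks N f x" "pairwise disjnt F"
    by auto
  have "(\<Sum>B\<in>blocks N f x. indicator F B) \<le> fbs_at N f x"
    using fbs_at_is_max fractional_packing_indicator[OF F(2,3)] by blast
  moreover have "(\<Sum>B\<in>blocks N f x. indicator F B) = real (card F)"
    using F(2) by (simp add: sum_indicator_card finite_blocks Int_absorb1)
  ultimately show ?thesis using F(1) by simp
qed

lemma block_sensitivity_le_fractional:
  "real (block_sensitivity N f) \<le> fractional_block_sensitivity N f"
proof -
  have "block_sensitivity N f \<in> bs_at N f ` cube N"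
    unfolding block_sensitivity_def using finite_cube cube_nonempty by (intro Max_in) auto
  then obtain x where x: "x \<in> cube N" "block_sensitivity N f = bs_at N f x" by auto
  have "fbs_at N f x \<le> fractional_block_sensitivity N f"
    unfolding fractional_block_sensitivity_def using finite_cube x by (intro Max_ge) auto
  then show ?thesis using bs_at_le_fbs_at[of N f x] x by simp
qed

lemma certificate_complexity_ge:
  assumes x: "x \<in> cube N"
    and ge: "\<And>S. S \<subseteq> {..<N} \<Longrightarrow> (\<And>B. B \<in> blocks N f x \<Longrightarrow> S \<inter> B \<noteq> {}) \<Longrightarrow> k \<le> card S"
  shows "k \<le> certificate_complexity N f"
proof -
  let ?C = "{card S |S. S \<subseteq> {..<N} \<and> (\<forall>B \<in> blocks N f x. S \<inter> B \<noteq> {})}"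
  have "?C \<subseteq> card ` Pow {..<N}" by auto
  then have "finite ?C" by (rule finite_subset) simp
  \<comment> \<open>Blocks are nonempty, so the full index set hits them all. The minimum in
    \<open>cert_at\<close> is thus over a nonempty set and is attained.\<close>
  moreover have "\<forall>B \<in> blocks N f x. {..<N} \<inter> B \<noteq> {}"
  proof
    fix B assume "B \<in> blocks N f x"
    then have "B \<noteq> {}" "{..<N} \<inter> B = B"
      using block_nonempty by (auto simp: blocks_def)
    then show "{..<N} \<inter> B \<noteq> {}" by simp
  qed
  then have "?C \<noteq> {}" by blast
  ultimately have "cert_at N f x \<in> ?C"
    unfolding cert_at_def by (rule Min_in)
  then have "k \<le> cert_at N f x" using ge by auto
  also have "\<dots> \<le> certificate_complexity N f"
    unfolding certificate_complexity_def using finite_cube x by (intro Max_ge) auto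
  finally show ?thesis .
qed

section \<open>The composed function\<close>

text \<open>Position \<open>i\<close> of row \<open>j\<close> has index \<open>j * n + i\<close>.
  Working with index sets instead of lists lets one operation cut supports, blocks and hitting sets
  into rows, and flipping becomes symmetric difference row by row.\<close>

definition row_part :: "nat \<Rightarrow> nat \<Rightarrow> nat set \<Rightarrow> nat set" where
  "row_part n j B = {i. i < n \<and> j * n + i \<in> B}"

definition support :: "bool list \<Rightarrow> nat set" where
  "support x = {i. i < length x \<and> x ! i}"

definition row_in :: "nat \<Rightarrow> nat set set \<Rightarrow> bool list \<Rightarrow> bool" where
  "row_in n A x \<longleftrightarrow> (\<exists>j<n. row_part n j (support x) \<in> A)"

lemma index_less_square:
  fixes i j n :: nat
  assumes "i < n" "j < n"
  shows "j * n + i < n\<^sup>2"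
proof -
  have "j * n + i < (j + 1) * n" using assms by simp
  also have "\<dots> \<le> n * n" using assms by (intro mult_right_mono) auto
  finally show ?thesis by (simp add: power2_eq_square)
qed

lemma support_flip:
  "B \<subseteq> {..<length x} \<Longrightarrow> support (flip x B) = sym_diff (support x) B"
  by (auto simp: support_def flip_def)

lemma row_sym_diff: "row_part n j (sym_diff X B) = sym_diff (row_part n j X) (row_part n j B)"
  by (auto simp: row_part_def)

lemma finite_row: "finite (row_part n j B)"
  by (simp add: row_part_def)

lemma row_subset: "row_part n j B \<subseteq> {..<n}"
  by (auto simp: row_part_def)

lemma inj_on_row_index: "inj_on (\<lambda>i. j * n + i) X" for j n :: nat
  by (simp add: inj_on_def)

lemma image_row_subset: "(\<lambda>i. j * n + i) ` row_part n j B \<subseteq> B"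
  by (auto simp: row_part_def)

lemma row_image: "a \<subseteq> {..<n} \<Longrightarrow> row_part n j ((\<lambda>i. j * n + i) ` a) = a"
  by (auto simp: row_part_def)

lemma sum_row_le:
  fixes z :: "nat \<Rightarrow> real"
  assumes "finite B" "\<And>i. i \<in> B \<Longrightarrow> 0 \<le> z i"
  shows "(\<Sum>i\<in>row_part n j B. z (j * n + i)) \<le> (\<Sum>i\<in>B. z i)"
proof -
  have "(\<Sum>i\<in>row_part n j B. z (j * n + i)) = (\<Sum>i\<in>(\<lambda>i. j * n + i) ` row_part n j B. z i)"
    by (simp add: sum.reindex[OF inj_on_row_index])
  also have "\<dots> \<le> (\<Sum>i\<in>B. z i)"
    using assms image_row_subset[of j n B] by (intro sum_mono2) auto
  finally show ?thesis .
qed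

lemma sum_card_row_le:
  assumes "finite S"
  shows "(\<Sum>j<n. card (row_part n j S)) \<le> card S"
proof -
  have "(\<Sum>j<n. card (row_part n j S)) = (\<Sum>j<n. card ((\<lambda>i. j * n + i) ` row_part n j S))"
    by (simp add: card_image[OF inj_on_row_index])
  also have "\<dots> = card (\<Union>j<n. (\<lambda>i. j * n + i) ` row_part n j S)"
  proof (rule card_UN_disjoint[symmetric])
    show "\<forall>j\<in>{..<n}. \<forall>k\<in>{..<n}. j \<noteq> k \<longrightarrow>
        (\<lambda>i. j * n + i) ` row_part n j S \<inter> (\<lambda>i. k * n + i) ` row_part n k S = {}"
    proof (intro ballI impI)
      fix j k :: nat assume "j \<noteq> k"
      \<comment> \<open>Division by \<open>n\<close> recovers the row number, so distinct rows are
        disjoint.\<close>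
      have div_n: "x div n = j" if "x \<in> (\<lambda>i. j * n + i) ` row_part n j S" for x j
        using that by (auto simp: row_part_def)
      show "(\<lambda>i. j * n + i) ` row_part n j S \<inter> (\<lambda>i. k * n + i) ` row_part n k S = {}"
        using div_n[of _ j] div_n[of _ k] \<open>j \<noteq> k\<close> by (metis disjoint_iff)
    qed
  qed (auto simp: finite_row)
  also have "\<dots> \<le> card S"
    using assms image_row_subset by (intro card_mono UN_least)
  finally show ?thesis .
qed

section \<open>Fractional hitting sets at accepting and rejecting inputs\<close>

lemma fbs_at_accepting_le:
  assumes x: "length x = n\<^sup>2" and acc: "row_in n A x"
  shows "fbs_at (n\<^sup>2) (row_in n A) x \<le> real n"
proof -
  obtain j where j: "j < n" "row_part n j (support x) \<in> A"
    using acc by (auto simp: row_in_def)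
  define R where "R = (\<lambda>i. j * n + i) ` {..<n}"
  have "fbs_at (n\<^sup>2) (row_in n A) x \<le> (\<Sum>i<n\<^sup>2. indicator R i)"
  proof (rule fbs_at_le_fractional_hitting_set)
    fix B assume "B \<in> blocks (n\<^sup>2) (row_in n A) x"
    then have B: "B \<subseteq> {..<n\<^sup>2}" "\<not> row_in n A (flip x B)"
      using acc by (auto simp: blocks_def)
    have "finite B" using B(1) by (rule finite_subset) simp
    \<comment> \<open>A block disjoint from row \<open>j\<close> would leave that row in
      \<open>A\<close>, and the flipped input would still be accepted.\<close>
    have "row_part n j B \<noteq> {}"
      using B j x by (auto simp: row_in_def support_flip row_sym_diff)
    then obtain i where "i < n" "j * n + i \<in> B" by (auto simp: row_part_def)
    then have "B \<inter> R \<noteq> {}" by (auto simp: R_def)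
    then have "1 \<le> card (B \<inter> R)" using \<open>finite B\<close> by (simp add: Suc_le_eq card_gt_0_iff)
    then show "1 \<le> (\<Sum>i\<in>B. indicator R i :: real)"
      using \<open>finite B\<close> by (simp add: sum_indicator_card)
  qed simp
  also have "\<dots> = real (card ({..<n\<^sup>2} \<inter> R))"
    by (simp add: sum_indicator_card)
  also have "\<dots> \<le> real (card R)"
    by (intro of_nat_mono card_mono) (auto simp: R_def)
  also have "\<dots> = real n"
    by (simp add: R_def card_image[OF inj_on_row_index])
  finally show ?thesis .
qed

lemma card_sym_diff_triangle:
  assumes "finite a" "finite b" "finite c"
  shows "card (sym_diff a b) \<le> card (sym_diff c a) + card (sym_diff c b)"
proof -
  have "card (sym_diff a b) \<le> card (sym_diff c a \<union> sym_diff c b)"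
    using assms by (intro card_mono) auto
  also have "\<dots> \<le> card (sym_diff c a) + card (sym_diff c b)"
    by (rule card_Un_le)
  finally show ?thesis .
qed

text \<open>By the triangle inequality two members of \<open>A\<close> within \<open>m/2\<close> of
  \<open>c\<close> are at distance at most \<open>m\<close>, hence equal. So there is at most one,
  and as it differs from \<open>c\<close>, any point of the difference serves as \<open>p\<close>.
  If there is none, every index serves vacuously.\<close>

lemma exists_hitting_near_sets:
  fixes n :: nat
  assumes A: "A \<subseteq> Pow {..<n}" "separated m A" and c: "c \<subseteq> {..<n}" "c \<notin> A" and "n > 0"
  shows "\<exists>p<n. \<forall>a\<in>A. 2 * card (sym_diff c a) \<le> m \<longrightarrow> p \<in> sym_diff c a"
proof (cases "\<exists>a\<in>A. 2 * card (sym_diff c a) \<le> m")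
  case True
  then obtain a where a: "a \<in> A" "2 * card (sym_diff c a) \<le> m" by blast
  then have "c \<noteq> a" using c by auto
  then have "sym_diff c a \<noteq> {}" by auto
  then obtain p where p: "p \<in> sym_diff c a" by blast
  have fin: "finite d" if "d \<subseteq> {..<n}" for d
    using that by (rule finite_subset) simp
  have "b = a" if "b \<in> A" "2 * card (sym_diff c b) \<le> m" for b
  proof (rule ccontr)
    assume "b \<noteq> a"
    then have "m < card (sym_diff b a)" using A that a by (auto simp: separated_def)
    moreover have "card (sym_diff b a) \<le> card (sym_diff c b) + card (sym_diff c a)"
      using A a that c by (intro card_sym_diff_triangle fin) auto
    ultimately show False using a that by linarith
  qed
  moreover have "p < n" using p A a c by auto
  ultimately show ?thesis using p by blast
next
  case False
  then show ?thesis using \<open>n > 0\<close> by blast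
qed

lemma fbs_at_rejecting_le:
  assumes A: "A \<subseteq> Pow {..<n}" "separated m A"
    and x: "length x = n\<^sup>2" and rej: "\<not> row_in n A x"
  shows "fbs_at (n\<^sup>2) (row_in n A) x \<le> real n + (real n)\<^sup>2 * (2 / (real m + 1))"
proof -
  define c where "c j = row_part n j (support x)" for j
  have "\<exists>p<n. \<forall>a\<in>A. 2 * card (sym_diff (c j) a) \<le> m \<longrightarrow> p \<in> sym_diff (c j) a" if "j < n" for j
    using that rej by (intro exists_hitting_near_sets[OF A]) (auto simp: c_def row_in_def row_subset)
  then obtain p where p: "\<And>j. j < n \<Longrightarrow> p j < n"
    "\<And>j a. j < n \<Longrightarrow> a \<in> A \<Longrightarrow> 2 * card (sym_diff (c j) a) \<le> m \<Longrightarrow> p j \<in> sym_diff (c j) a"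
    by metis
  define P where "P = (\<lambda>j. j * n + p j) ` {..<n}"
  \<comment> \<open>A row change leading to a member of \<open>A\<close> farther than
    \<open>m/2\<close> has at least \<open>(m + 1)/2\<close> elements, so this uniform weight gives
    it total weight at least 1.\<close>
  define u :: real where "u = 2 / (real m + 1)"
  define z where "z i = indicator P i + u" for i
  have u: "u \<ge> 0" by (simp add: u_def)
  have z: "0 \<le> z i" for i using u by (simp add: z_def)
  have "fbs_at (n\<^sup>2) (row_in n A) x \<le> (\<Sum>i<n\<^sup>2. z i)"
  proof (rule fbs_at_le_fractional_hitting_set)
    fix B assume "B \<in> blocks (n\<^sup>2) (row_in n A) x"
    then have B: "B \<subseteq> {..<n\<^sup>2}" "row_in n A (flip x B)"
      using rej by (auto simp: blocks_def)
    have "finite B" using B(1) by (rule finite_subset) simp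
    obtain j where j: "j < n" "sym_diff (c j) (row_part n j B) \<in> A"
      using B x by (auto simp: row_in_def support_flip row_sym_diff c_def)
    define a where "a = sym_diff (c j) (row_part n j B)"
    have aA: "a \<in> A" using j by (simp add: a_def)
    have rB: "row_part n j B = sym_diff (c j) a" by (auto simp: a_def)
    have "1 \<le> (\<Sum>i\<in>row_part n j B. z (j * n + i))"
    \<comment> \<open>A short change leads to the unique near member of \<open>A\<close> and so
      contains the heavy coordinate \<open>p j\<close>; a long change is covered by the uniform
      weight alone.\<close>
    proof (cases "2 * card (row_part n j B) \<le> m")
      case True
      then have "p j \<in> row_part n j B"
        using p(2)[OF j(1) aA] unfolding rB by blast
      then have "z (j * n + p j) \<le> (\<Sum>i\<in>row_part n j B. z (j * n + i))"
        using z by (intro member_le_sum) (auto simp: finite_row)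
      moreover have "j * n + p j \<in> P" using j by (auto simp: P_def)
      ultimately show ?thesis using u by (simp add: z_def)
    next
      case False
      then have "real m + 1 \<le> 2 * real (card (row_part n j B))" by linarith
      then have "1 \<le> real (card (row_part n j B)) * u"
        by (simp add: u_def field_simps)
      also have "\<dots> = (\<Sum>i\<in>row_part n j B. u)" by simp
      also have "\<dots> \<le> (\<Sum>i\<in>row_part n j B. z (j * n + i))"
        by (intro sum_mono) (simp add: z_def)
      finally show ?thesis .
    qed
    also have "\<dots> \<le> (\<Sum>i\<in>B. z i)"
      using \<open>finite B\<close> z by (intro sum_row_le) auto
    finally show "1 \<le> (\<Sum>i\<in>B. z i)" .
  qed (rule z)
  also have "\<dots> = real (card ({..<n\<^sup>2} \<inter> P)) + (real n)\<^sup>2 * u"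
    by (simp add: z_def sum.distrib sum_indicator_card)
  also have "card ({..<n\<^sup>2} \<inter> P) \<le> card P"
    by (intro card_mono) (auto simp: P_def)
  also have "card P \<le> n"
    unfolding P_def using card_image_le[of "{..<n}"] by simp
  finally show ?thesis by (simp add: u_def)
qed

section \<open>Certificates at the zero input\<close>

lemma certificate_complexity_row_in_ge:
  assumes A: "A \<subseteq> Pow {..<n}" "{} \<notin> A"
    and avoid: "\<And>S. S \<in> small_sets n m \<Longrightarrow> \<exists>a\<in>A. a \<inter> S = {}"
  shows "n * (m + 1) \<le> certificate_complexity (n\<^sup>2) (row_in n A)"
proof (rule certificate_complexity_ge)
  let ?x = "replicate (n\<^sup>2) False"
  show "?x \<in> cube (n\<^sup>2)" by (simp add: cube_def)
  have supp: "support ?x = {}" by (auto simp: support_def)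
  then have rej: "\<not> row_in n A ?x"
    using A by (simp add: row_in_def row_part_def)
  fix S assume S: "S \<subseteq> {..<n\<^sup>2}"
    and hit: "\<And>B. B \<in> blocks (n\<^sup>2) (row_in n A) ?x \<Longrightarrow> S \<inter> B \<noteq> {}"
  have "m + 1 \<le> card (row_part n j S)" if j: "j < n" for j
  proof (rule ccontr)
    assume "\<not> m + 1 \<le> card (row_part n j S)"
    then have "row_part n j S \<in> small_sets n m"
      by (simp add: small_sets_def row_subset)
    then obtain a where a: "a \<in> A" "a \<inter> row_part n j S = {}" using avoid by blast
    have an: "a \<subseteq> {..<n}" using a A by auto
    \<comment> \<open>A copy of \<open>a\<close> in row \<open>j\<close>. Flipping it in the zero
      input puts \<open>a\<close> itself into that row, so it is a block, yet it misses
      \<open>S\<close> by the choice of \<open>a\<close>.\<close>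
    define B where "B = (\<lambda>i. j * n + i) ` a"
    have B: "B \<subseteq> {..<n\<^sup>2}"
      using an j by (auto simp: B_def intro!: index_less_square)
    then have "support (flip ?x B) = B"
      by (subst support_flip) (auto simp: supp)
    then have "row_in n A (flip ?x B)"
      using a j row_image[OF an, of j] by (auto simp: row_in_def B_def)
    then have "B \<in> blocks (n\<^sup>2) (row_in n A) ?x"
      using B rej by (simp add: blocks_def)
    then have "S \<inter> B \<noteq> {}" by (rule hit)
    then show False using a an by (auto simp: B_def row_part_def)
  qed
  then have "(\<Sum>j<n. m + 1) \<le> (\<Sum>j<n. card (row_part n j S))"
    by (intro sum_mono) simp
  also have "\<dots> \<le> card S"
    using S by (intro sum_card_row_le) (rule finite_subset, auto)
  finally show "n * (m + 1) \<le> card S" by simp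
qed

theorem mainTheorem4:
  shows "\<exists>(c :: real) (c' :: real) (n0 :: nat). c > 0 \<and> c' > 0 \<and>
    (\<forall>n \<ge> n0. \<exists>f :: bool list \<Rightarrow> bool.
       real (block_sensitivity (n\<^sup>2) f) \<le> fractional_block_sensitivity (n\<^sup>2) f \<and>
       fractional_block_sensitivity (n\<^sup>2) f \<le> c * real n \<and>
       real (certificate_complexity (n\<^sup>2) f) \<ge> c' * (real n)\<^sup>2)"
proof -
  \<comment> \<open>Both constants come from \<open>n \<le> 14 * (m + 1)\<close>: the rejecting
    bound is at most \<open>n + 28 * n\<close>, and \<open>n * (m + 1)\<close> is at least
    \<open>n * n / 14\<close>.\<close>
  have "\<exists>f :: bool list \<Rightarrow> bool.
       real (block_sensitivity (n\<^sup>2) f) \<le> fractional_block_sensitivity (n\<^sup>2) f \<and>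
       fractional_block_sensitivity (n\<^sup>2) f \<le> 29 * real n \<and>
       real (certificate_complexity (n\<^sup>2) f) \<ge> 1/14 * (real n)\<^sup>2" if n: "n \<ge> 1" for n
  proof -
    \<comment> \<open>The largest radius allowed by the hypothesis \<open>14 * m \<le> n\<close> of
      the greedy construction.\<close>
    define m where "m = n div 14"
    have "n < 14 * (m + 1)" unfolding m_def by presburger
    then have "real n \<le> real (14 * (m + 1))" by (intro of_nat_mono) simp
    then have m: "real n \<le> 14 * (real m + 1)" by simp
    obtain A where A: "A \<subseteq> Pow {..<n}" "{} \<notin> A" "separated m A"
      "\<And>S. S \<in> small_sets n m \<Longrightarrow> \<exists>a\<in>A. a \<inter> S = {}"
      using exists_separated_avoiding[of m n] n by (auto simp: m_def)
    have "fbs_at (n\<^sup>2) (row_in n A) x \<le> 29 * real n" if x: "x \<in> cube (n\<^sup>2)" for x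
    proof (cases "row_in n A x")
      case True
      then show ?thesis
        using fbs_at_accepting_le[of x n A] x by (simp add: cube_def)
    next
      case False
      then have "fbs_at (n\<^sup>2) (row_in n A) x \<le> real n + (real n)\<^sup>2 * (2 / (real m + 1))"
        using fbs_at_rejecting_le[OF A(1,3)] x by (simp add: cube_def)
      also have "(real n)\<^sup>2 * (2 / (real m + 1)) = real n * (2 * (real n / (real m + 1)))"
        by (simp add: power2_eq_square)
      also have "\<dots> \<le> real n * (2 * 14)"
        using m by (intro mult_left_mono) (auto simp: pos_divide_le_eq)
      finally show ?thesis by simp
    qed
    then have "fractional_block_sensitivity (n\<^sup>2) (row_in n A) \<le> 29 * real n"
      unfolding fractional_block_sensitivity_def
      using finite_cube cube_nonempty by (subst Max_le_iff) auto
    moreover have "1/14 * (real n)\<^sup>2 \<le> real (n * (m + 1))"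
      using mult_left_mono[OF m, of "real n"] by (simp add: power2_eq_square algebra_simps)
    then have "1/14 * (real n)\<^sup>2 \<le> real (certificate_complexity (n\<^sup>2) (row_in n A))"
      using certificate_complexity_row_in_ge[OF A(1,2,4)] by (rule order_trans[OF _ of_nat_mono])
    ultimately show ?thesis
      using block_sensitivity_le_fractional by blast
  qed
  then show ?thesis
    by (intro exI[of _ "29 :: real"] exI[of _ "1/14 :: real"] exI[of _ "1 :: nat"]) auto
qed

end
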